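(* Let $N>0$ be a real number and let $r$ be an odd positive integer. Let $a_r, a_{r-1},\ldots,a_1$ be positive integers chosen successively as follows: $a_r>N+1$, and put $s_r=1-\frac{N+1}{a_r}$; then for $i=r-1,r-2,\ldots,1$: if $i$ is even, choose $a_i>\frac{N}{s_{i+1}}$ and put $s_i=g\!\left(s_{i+1},-\frac{N}{a_i}\right)$; if $i$ is odd, choose $a_i>\frac{N+1}{1-\frac{1}{s_{i+1}}}$ and put $s_i=f\!\left(s_{i+1},1-\frac{N+1}{a_i}\right)$. Then the threshold graph $T_G(a_1,a_2,\ldots,a_r)$ is $(0,N]$-eigenvalue free.
   Context: All graphs are finite, simple and undirected; eigenvalues are those of the adjacency matrix. A graph is $I$-eigenvalue free, for an interval $I\subseteq\mathbb{R}$, if it has no eigenvalue in $I$. For an integer $r\ge 1$ and positive integers $a_1,\ldots,a_r$ with $a_r\ge 2$, the threshold graph $T_G(a_1,\ldots,a_r)$ is defined as follows: start with $G_r=K_{a_r}$ (complete graph) if $r$ is odd and $G_r=\overline{K_{a_r}}$ ($a_r$ isolated vertices) if $r$ is even; for $i=r-1,\ldots,1$, let $G_i$ be obtained from $G_{i+1}$ by adding $a_i$ new vertices which are adjacent to each other and to all vertices of $G_{i+1}$ if $i$ is odd, and by adding $a_i$ new isolated vertices if $i$ is even; then $T_G(a_1,\ldots,a_r)=G_1$. (Equivalently, in the cotree, the interior node at depth $i$ is a join node if $i$ is odd and a union node if $i$ is even, and has $a_i$ leaves.) The functions $f,g$ are $f(X,Y)=\frac{XY-1}{X+Y-2}$ and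 $g(X,Y)=\frac{XY}{X+Y}$. *)

theory Defs
  imports "Graph_Theory.Pair_Digraph" "Jordan_Normal_Form.Char_Poly"
begin

text \<open>
  A finite simple undirected graph is a \<^const>\<open>pair_graph\<close>: the undirected edge
  \<open>uv\<close> is represented by the two arcs \<open>(u, v)\<close> and \<open>(v, u)\<close>.
\<close>

definition complete_graph_on :: "'a set \<Rightarrow> 'a pair_pre_digraph" where
  "complete_graph_on W = \<lparr>pverts = W, parcs = {(u, v). u \<in> W \<and> v \<in> W \<and> u \<noteq> v}\<rparr>"

definition edgeless_graph_on :: "'a set \<Rightarrow> 'a pair_pre_digraph" where
  "edgeless_graph_on W = \<lparr>pverts = W, parcs = {}\<rparr>"

text \<open>In the next two definitions \<open>W\<close> is meant to be disjoint from the vertices of \<open>G\<close>.\<close>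

definition add_dominating :: "'a set \<Rightarrow> 'a pair_pre_digraph \<Rightarrow> 'a pair_pre_digraph" where
  "add_dominating W G =
     \<lparr>pverts = W \<union> pverts G,
      parcs = parcs G \<union> {(u, v). u \<in> W \<and> v \<in> W \<and> u \<noteq> v} \<union> W \<times> pverts G \<union> pverts G \<times> W\<rparr>"

definition add_isolated :: "'a set \<Rightarrow> 'a pair_pre_digraph \<Rightarrow> 'a pair_pre_digraph" where
  "add_isolated W G = \<lparr>pverts = W \<union> pverts G, parcs = parcs G\<rparr>"

text \<open>
  The \<open>m\<close> vertices introduced at depth \<open>i\<close>. Tagging them with \<open>i\<close> makes the vertex sets
  of different depths disjoint.
\<close>

definition level_verts :: "nat \<Rightarrow> nat \<Rightarrow> (nat \<times> nat) set" where
  "level_verts i m = {i} \<times> {..<m}"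

text \<open>
  \<open>threshold_from i [a\<^sub>i, \<dots>, a\<^sub>r]\<close> is the graph \<open>G\<^sub>i\<close>, so that
  \<open>T\<^sub>G(a\<^sub>1, \<dots>, a\<^sub>r) = G\<^sub>1\<close>. The empty list is a junk case.
\<close>

fun threshold_from :: "nat \<Rightarrow> nat list \<Rightarrow> (nat \<times> nat) pair_pre_digraph" where
  "threshold_from i [] = edgeless_graph_on {}"
| "threshold_from i [m] =
     (if odd i then complete_graph_on (level_verts i m) else edgeless_graph_on (level_verts i m))"
| "threshold_from i (m # n # ns) =
     (if odd i then add_dominating (level_verts i m) (threshold_from (Suc i) (n # ns))
      else add_isolated (level_verts i m) (threshold_from (Suc i) (n # ns)))"

definition threshold_graph :: "nat list \<Rightarrow> (nat \<times> nat) pair_pre_digraph" where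
  "threshold_graph as = threshold_from 1 as"

definition adjacency_matrix :: "'a list \<Rightarrow> 'a pair_pre_digraph \<Rightarrow> real mat" where
  "adjacency_matrix vs G =
     mat (length vs) (length vs) (\<lambda>(i, j). if (vs ! i, vs ! j) \<in> parcs G then 1 else 0)"

text \<open>
  The list \<open>vs\<close> enumerates the vertices; different enumerations give similar adjacency
  matrices. These are real symmetric, so all their eigenvalues are real.
\<close>

definition graph_eigenvalue :: "'a pair_pre_digraph \<Rightarrow> real \<Rightarrow> bool" where
  "graph_eigenvalue G k \<longleftrightarrow>
     (\<exists>vs. distinct vs \<and> set vs = pverts G \<and> eigenvalue (adjacency_matrix vs G) k)"

definition eigenvalue_free :: "real set \<Rightarrow> 'a pair_pre_digraph \<Rightarrow> bool" where
  "eigenvalue_free I G \<longleftrightarrow> (\<forall>k\<in>I. \<not> graph_eigenvalue G k)"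

definition f_fun :: "real \<Rightarrow> real \<Rightarrow> real" where
  "f_fun X Y = (X * Y - 1) / (X + Y - 2)"

definition g_fun :: "real \<Rightarrow> real \<Rightarrow> real" where
  "g_fun X Y = X * Y / (X + Y)"

lemma threshold_from_levels: "p \<in> pverts (threshold_from i as) \<Longrightarrow> i \<le> fst p"
  by (induction i as arbitrary: p rule: threshold_from.induct)
     (force simp: complete_graph_on_def edgeless_graph_on_def add_dominating_def add_isolated_def
        level_verts_def split: if_splits dest: Suc_leD)+

lemma level_verts_disjoint: "level_verts i m \<inter> pverts (threshold_from (Suc i) as) = {}"
  using threshold_from_levels[of _ "Suc i" as] by (force simp: level_verts_def)

lemma pair_graphI:
  assumes "finite (pverts G)" "parcs G \<subseteq> pverts G \<times> pverts G" "sym (parcs G)"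
    and "\<And>u. (u, u) \<notin> parcs G"
  shows "pair_graph G"
proof
  show "finite (parcs G)"
    using assms(1,2) finite_subset by blast
  show "symmetric (with_proj G)"
    using assms(3) by (simp add: symmetric_def arcs_ends_conv)
qed (use assms in \<open>auto\<close>)

lemma pair_graph_threshold_from: "pair_graph (threshold_from i as)"
proof -
  have fin: "finite (level_verts i m)" for i m
    by (simp add: level_verts_def)
  have "finite (pverts G) \<and> parcs G \<subseteq> pverts G \<times> pverts G \<and> sym (parcs G) \<and> (\<forall>u. (u, u) \<notin> parcs G)"
    if "G = threshold_from i as" for G
    using that
  proof (induction i as arbitrary: G rule: threshold_from.induct)
    case (3 i m n ns)
    define H where "H = threshold_from (Suc i) (n # ns)"
    have H: "finite (pverts H)" "parcs H \<subseteq> pverts H \<times> pverts H" "sym (parcs H)"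
        "\<And>u. (u, u) \<notin> parcs H"
      using "3.IH" unfolding H_def by (cases "odd i"; blast)+
    have disj: "level_verts i m \<inter> pverts H = {}"
      unfolding H_def by (rule level_verts_disjoint)
    have G: "G = (if odd i then add_dominating (level_verts i m) H else add_isolated (level_verts i m) H)"
      using "3.prems" by (simp add: H_def)
    show ?case
      using H disj fin unfolding G
      by (auto simp: add_dominating_def add_isolated_def sym_def)
  qed (auto simp: complete_graph_on_def edgeless_graph_on_def fin sym_def)
  then show ?thesis
    by (intro pair_graphI) auto
qed

lemma pair_graph_threshold_graph: "pair_graph (threshold_graph as)"
  unfolding threshold_graph_def by (rule pair_graph_threshold_from)

end

theory Submission
  imports Defs
begin

text \<open>
  Let \<open>h\<close> be an eigenvector of the threshold graph for an eigenvalue \<open>k \<in> (0, N]\<close>. Seen from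
  the subgraph \<open>G\<^sub>i\<close>, the dominating vertices added later contribute the same number \<open>d\<close> to
  the eigenvalue equation at every vertex. With \<open>t\<close> the sum of \<open>h\<close> over \<open>G\<^sub>i\<close>, descending
  induction on \<open>i\<close> gives \<open>d = - \<sigma> t\<close>, where \<open>\<sigma>\<close> is obtained by the recursion for \<open>s\<^sub>i\<close> with
  \<open>N\<close> replaced by \<open>k\<close>. Since \<open>1 - f\<close> is the parallel sum of \<open>1 - X\<close> and \<open>1 - Y\<close>, and \<open>g\<close> is the
  parallel sum of \<open>X\<close> and \<open>Y\<close>, the recursion is monotone: \<open>s\<^sub>i \<le> \<sigma> < 1\<close> with \<open>s\<^sub>i > 0\<close> for
  odd \<open>i\<close>, and \<open>s\<^sub>i \<le> \<sigma> < 0\<close> for even \<open>i\<close>. Hence \<open>\<sigma> \<noteq> 0\<close>, and \<open>d = 0\<close> on \<open>G\<^sub>1\<close> forces \<open>h = 0\<close>.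
\<close>

section \<open>Eigenvectors with a constant shift, level by level\<close>

text \<open>\<open>h\<close> is allowed to be zero, because an eigenvector of the whole graph may
  vanish on a subgraph.\<close>

definition shifted_eigenvector ::
    "'a pair_pre_digraph \<Rightarrow> real \<Rightarrow> real \<Rightarrow> ('a \<Rightarrow> real) \<Rightarrow> bool" where
  "shifted_eigenvector G k d h \<longleftrightarrow>
     (\<forall>u\<in>pverts G. k * h u = d + (\<Sum>w\<in>{w \<in> pverts G. (u, w) \<in> parcs G}. h w))"

lemma graph_eigenvalue_imp_shifted_eigenvector:
  assumes "graph_eigenvalue G k"
  obtains h where "shifted_eigenvector G k 0 h" "\<exists>u\<in>pverts G. h u \<noteq> 0"
proof -
  obtain vs where vs: "distinct vs" "set vs = pverts G"
    and ev: "eigenvalue (adjacency_matrix vs G) k"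
    using assms unfolding graph_eigenvalue_def by blast
  let ?A = "adjacency_matrix vs G" and ?n = "length vs"
  obtain v where v: "v \<in> carrier_vec ?n" "v \<noteq> 0\<^sub>v ?n" "?A *\<^sub>v v = k \<cdot>\<^sub>v v"
    using ev unfolding eigenvalue_def eigenvector_def by (auto simp: adjacency_matrix_def)
  define h where "h u = v $ (THE i. i < ?n \<and> vs ! i = u)" for u
  have h: "h (vs ! i) = v $ i" if "i < ?n" for i
  proof -
    have "(THE j. j < ?n \<and> vs ! j = vs ! i) = i"
      using that vs(1) by (intro the_equality) (auto simp: nth_eq_iff_index_eq)
    then show ?thesis by (simp add: h_def)
  qed
  have bij: "bij_betw ((!) vs) {..<?n} (pverts G)"
    using bij_betw_nth[OF vs(1) refl refl] vs(2) by simp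
  have fin: "finite (pverts G)"
    using vs(2) by (metis List.finite_set)
  have "shifted_eigenvector G k 0 h"
    unfolding shifted_eigenvector_def
  proof
    fix u assume "u \<in> pverts G"
    then obtain i where i: "i < ?n" "u = vs ! i"
      using vs(2) by (metis in_set_conv_nth)
    have "k * h u = (?A *\<^sub>v v) $ i"
      using i v h by simp
    also have "\<dots> = (\<Sum>j<?n. (if (u, vs ! j) \<in> parcs G then 1 else 0) * h (vs ! j))"
      using i v(1) h by (auto simp: adjacency_matrix_def scalar_prod_def lessThan_atLeast0
          intro!: sum.cong)
    also have "\<dots> = (\<Sum>w\<in>pverts G. (if (u, w) \<in> parcs G then 1 else 0) * h w)"
      by (rule sum.reindex_bij_betw[OF bij])
    also have "\<dots> = (\<Sum>w\<in>pverts G. if (u, w) \<in> parcs G then h w else 0)"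
      by (intro sum.cong) auto
    also have "\<dots> = (\<Sum>w\<in>{w \<in> pverts G. (u, w) \<in> parcs G}. h w)"
      using fin by (rule sum.inter_filter[symmetric])
    finally show "k * h u = 0 + \<dots>" by simp
  qed
  moreover obtain i where "i < ?n" "v $ i \<noteq> 0"
    using v(1,2) by (metis carrier_vecD eq_vecI index_zero_vec(1,2))
  then have "\<exists>u\<in>pverts G. h u \<noteq> 0"
    using h vs(2) by (metis nth_mem)
  ultimately show ?thesis
    using that by blast
qed

text \<open>A vertex of \<open>W\<close> sees all of \<open>W\<close> except itself; adding
  \<open>h u\<close> to both sides turns \<open>k\<close> into \<open>k + 1\<close>, whence
  \<open>N + 1\<close> at odd levels. A vertex of \<open>G\<close> sees the whole of
  \<open>W\<close>, so \<open>sum h W\<close> joins the shift.\<close>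

lemma shifted_eigenvector_add_dominating:
  assumes "finite W" "finite (pverts G)" "W \<inter> pverts G = {}"
    and "parcs G \<subseteq> pverts G \<times> pverts G"
    and sh: "shifted_eigenvector (add_dominating W G) k d h"
  shows "\<forall>u\<in>W. (k + 1) * h u = d + sum h W + sum h (pverts G)"
    and "shifted_eigenvector G k (d + sum h W) h"
proof -
  let ?D = "add_dominating W G"
  have eq: "k * h u = d + (\<Sum>w\<in>{w \<in> pverts ?D. (u, w) \<in> parcs ?D}. h w)"
    if "u \<in> W \<union> pverts G" for u
    using sh that by (auto simp: shifted_eigenvector_def add_dominating_def)
  show "\<forall>u\<in>W. (k + 1) * h u = d + sum h W + sum h (pverts G)"
  proof
    fix u assume u: "u \<in> W"
    have "{w \<in> pverts ?D. (u, w) \<in> parcs ?D} = (W - {u}) \<union> pverts G"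
      using u assms(3,4) by (auto simp: add_dominating_def)
    moreover have "sum h ((W - {u}) \<union> pverts G) = sum h (W - {u}) + sum h (pverts G)"
      using assms by (intro sum.union_disjoint) auto
    moreover have "sum h (W - {u}) = sum h W - h u"
      using u assms(1) by (simp add: sum_diff1)
    ultimately show "(k + 1) * h u = d + sum h W + sum h (pverts G)"
      using eq[of u] u by (simp add: algebra_simps)
  qed
  show "shifted_eigenvector G k (d + sum h W) h"
    unfolding shifted_eigenvector_def
  proof
    fix u assume u: "u \<in> pverts G"
    have "{w \<in> pverts ?D. (u, w) \<in> parcs ?D} = W \<union> {w \<in> pverts G. (u, w) \<in> parcs G}"
      using u assms(3,4) by (auto simp: add_dominating_def)
    moreover have "sum h (W \<union> {w \<in> pverts G. (u, w) \<in> parcs G})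
        = sum h W + sum h {w \<in> pverts G. (u, w) \<in> parcs G}"
      using assms by (intro sum.union_disjoint) auto
    ultimately show "k * h u = d + sum h W + sum h {w \<in> pverts G. (u, w) \<in> parcs G}"
      using eq[of u] u by simp
  qed
qed

text \<open>New vertices see only the shift and are not seen from \<open>G\<close>, whence plain
  \<open>N\<close> at even levels.\<close>

lemma shifted_eigenvector_add_isolated:
  assumes "W \<inter> pverts G = {}" and "parcs G \<subseteq> pverts G \<times> pverts G"
    and sh: "shifted_eigenvector (add_isolated W G) k d h"
  shows "\<forall>u\<in>W. k * h u = d" and "shifted_eigenvector G k d h"
proof -
  let ?D = "add_isolated W G"
  have eq: "k * h u = d + (\<Sum>w\<in>{w \<in> pverts ?D. (u, w) \<in> parcs ?D}. h w)"
    if "u \<in> W \<union> pverts G" for u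
    using sh that by (auto simp: shifted_eigenvector_def add_isolated_def)
  show "\<forall>u\<in>W. k * h u = d"
  proof
    fix u assume u: "u \<in> W"
    have "{w \<in> pverts ?D. (u, w) \<in> parcs ?D} = {}"
      using u assms(1,2) by (auto simp: add_isolated_def)
    then show "k * h u = d"
      using eq[of u] u by (metis UnI1 add.right_neutral sum.empty)
  qed
  show "shifted_eigenvector G k d h"
    unfolding shifted_eigenvector_def
  proof
    fix u assume u: "u \<in> pverts G"
    have "{w \<in> pverts ?D. (u, w) \<in> parcs ?D} = {w \<in> pverts G. (u, w) \<in> parcs G}"
      using assms(2) by (auto simp: add_isolated_def)
    then show "k * h u = d + sum h {w \<in> pverts G. (u, w) \<in> parcs G}"
      using eq[of u] u by simp
  qed
qed

text \<open>Lets the innermost level reuse the equation for dominating vertices, over the empty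
  graph.\<close>

lemma complete_graph_on_eq_add_dominating:
  "complete_graph_on W = add_dominating W (edgeless_graph_on {})"
  by (simp add: complete_graph_on_def add_dominating_def edgeless_graph_on_def)

section \<open>Parallel-sum form and monotonicity of \<open>f_fun\<close> and
  \<open>g_fun\<close>\<close>

text \<open>With \<open>x = 1 - X\<close> and \<open>y = 1 - Y\<close>, the quotient becomes
  \<open>1 - x * y / (x + y)\<close>.\<close>

lemma one_minus_f_fun:
  assumes "X < 1" "Y < 1"
  shows "1 - f_fun X Y = 1 / (1 / (1 - X) + 1 / (1 - Y))"
proof -
  have "(1 - X) + (1 - Y) > 0" using assms by simp
  then have "X + Y - 2 \<noteq> 0" "1 / (1 - X) + 1 / (1 - Y) = (2 - X - Y) / ((1 - X) * (1 - Y))"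
    using assms by (auto simp: field_simps)
  then show ?thesis
    by (simp add: f_fun_def field_simps)
qed

text \<open>If \<open>X + Y = 0\<close>, both sides are 0 by the convention for division by
  zero.\<close>

lemma g_fun_eq:
  assumes "X \<noteq> 0" "Y \<noteq> 0"
  shows "g_fun X Y = 1 / (1 / X + 1 / Y)"
  using assms by (simp add: g_fun_def add_divide_eq_iff divide_add_eq_iff add.commute)

text \<open>\<open>Q\<close> and \<open>q\<close> stand for \<open>(N + 1) / a i\<close> and
  \<open>(k + 1) / a i\<close>. A parallel sum of positive numbers grows with each of them, which
  compares \<open>1 - \<sigma>\<close> with \<open>1 - s\<close>.\<close>

lemma f_fun_bounds:
  assumes "s' \<le> \<sigma>'" "\<sigma>' < 0" "0 < q" "q \<le> Q" "Q < 1 - 1 / s'"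
  defines "s \<equiv> f_fun s' (1 - Q)" and "\<sigma> \<equiv> f_fun \<sigma>' (1 - q)"
  shows "0 < s" "s \<le> \<sigma>" "\<sigma> < 1"
proof -
  have s: "1 - s = 1 / (1 / (1 - s') + 1 / Q)"
    using assms one_minus_f_fun[of s' "1 - Q"] by simp
  have \<sigma>: "1 - \<sigma> = 1 / (1 / (1 - \<sigma>') + 1 / q)"
    using assms one_minus_f_fun[of \<sigma>' "1 - q"] by simp
  have "1 / (1 - 1 / s') < 1 / Q"
    using assms by (intro divide_strict_left_mono) (auto simp: field_simps)
  \<comment> \<open>The reciprocals of \<open>1 - s'\<close> and \<open>1 - 1 / s'\<close> add up to
    1, so \<open>Q = 1 - 1 / s'\<close> would give \<open>s = 0\<close>; a smaller \<open>Q\<close>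
    gives \<open>s > 0\<close>.\<close>
  moreover have "1 / (1 - 1 / s') = 1 - 1 / (1 - s')"
  proof -
    have "1 - 1 / s' = (1 - s') / - s'" "1 - s' \<noteq> 0"
      using assms by (auto simp: field_simps)
    then show ?thesis
      by (simp add: diff_divide_eq_iff)
  qed
  ultimately have 1: "1 < 1 / (1 - s') + 1 / Q"
    by linarith
  then have "1 / (1 / (1 - s') + 1 / Q) < 1"
    by simp
  then show "0 < s" using s by linarith
  have "1 / (1 - s') \<le> 1 / (1 - \<sigma>')" "1 / Q \<le> 1 / q"
    using assms by (auto intro!: divide_left_mono)
  then have le: "1 / (1 - s') + 1 / Q \<le> 1 / (1 - \<sigma>') + 1 / q"
    by linarith
  then have "1 / (1 / (1 - \<sigma>') + 1 / q) \<le> 1 / (1 / (1 - s') + 1 / Q)"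
    using 1 by (intro divide_left_mono) auto
  then show "s \<le> \<sigma>" using s \<sigma> by linarith
  have "1 / (1 / (1 - \<sigma>') + 1 / q) > 0"
    using le 1 by simp
  then show "\<sigma> < 1" using \<sigma> by linarith
qed

text \<open>\<open>Q < s'\<close> makes both sums of reciprocals negative, and on the negative
  numbers taking reciprocals still reverses the order.\<close>

lemma g_fun_bounds:
  assumes "0 < s'" "s' \<le> \<sigma>'" "0 < q" "q \<le> Q" "Q < s'"
  shows "g_fun s' (- Q) \<le> g_fun \<sigma>' (- q)" "g_fun \<sigma>' (- q) < 0"
proof -
  have s: "g_fun s' (- Q) = 1 / (1 / s' - 1 / Q)" and \<sigma>: "g_fun \<sigma>' (- q) = 1 / (1 / \<sigma>' - 1 / q)"
    using assms g_fun_eq[of s' "- Q"] g_fun_eq[of \<sigma>' "- q"] by simp_all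
  have "1 / s' < 1 / Q" "1 / \<sigma>' \<le> 1 / s'" "1 / Q \<le> 1 / q"
    using assms by (auto intro!: divide_left_mono divide_strict_left_mono)
  then have *: "1 / \<sigma>' - 1 / q \<le> 1 / s' - 1 / Q" "1 / s' - 1 / Q < 0"
    by linarith+
  then show "g_fun s' (- Q) \<le> g_fun \<sigma>' (- q)"
    unfolding s \<sigma> by (intro divide_left_mono mult_neg_neg) auto
  show "g_fun \<sigma>' (- q) < 0"
    unfolding \<sigma> using * by (simp add: divide_less_0_iff)
qed

section \<open>The shift as a multiple of the vertex sum\<close>

text \<open>\<open>A\<close> and \<open>t\<close> are the sums over the new level and the inner
  graph. The third assumption is the eigenvalue equation summed over the level, the fourth the
  induction hypothesis for the inner shift \<open>d + A\<close>.\<close>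

lemma f_fun_shift:
  assumes "\<sigma>' < 1" "0 < q" "q * A = d + A + t" "d + A = - \<sigma>' * t"
  shows "d = - f_fun \<sigma>' (1 - q) * (A + t)"
proof -
  have nz: "\<sigma>' - 1 - q \<noteq> 0" using assms by simp
  have t: "q * A = (1 - \<sigma>') * t" using assms(3,4) by (simp add: algebra_simps)
  have d: "d = - \<sigma>' * t - A" using assms(4) by simp
  \<comment> \<open>The claim with the denominator of \<open>f_fun\<close> cleared, grouped so that
    both brackets vanish.\<close>
  have "d * (\<sigma>' - 1 - q) + (\<sigma>' * (1 - q) - 1) * (A + t)
      = \<sigma>' * ((1 - \<sigma>') * t - q * A) + (q * A - (1 - \<sigma>') * t)"
    unfolding d by (simp add: algebra_simps)
  also have "\<dots> = 0"
    unfolding t by simp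
  finally have "d * (\<sigma>' - 1 - q) = - (\<sigma>' * (1 - q) - 1) * (A + t)"
    by (metis eq_neg_iff_add_eq_0 mult_minus_left)
  then have "d = - (\<sigma>' * (1 - q) - 1) * (A + t) / (\<sigma>' - 1 - q)"
    using nz by (simp add: nonzero_eq_divide_eq)
  moreover have "f_fun \<sigma>' (1 - q) = (\<sigma>' * (1 - q) - 1) / (\<sigma>' - 1 - q)"
    by (simp add: f_fun_def)
  ultimately show ?thesis
    by (metis minus_divide_left times_divide_eq_left)
qed

lemma g_fun_shift:
  assumes "0 < q" "q < \<sigma>'" "q * A = d" "d = - \<sigma>' * t"
  shows "d = - g_fun \<sigma>' (- q) * (A + t)"
proof -
  have nz: "\<sigma>' - q \<noteq> 0" using assms by simp
  \<comment> \<open>Take \<sigma>' times the third assumption minus \<open>q\<close> times the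
    fourth.\<close>
  have "d * (\<sigma>' - q) = \<sigma>' * q * (A + t)"
    using assms(3,4) by (simp add: algebra_simps)
  then have "d = \<sigma>' * q * (A + t) / (\<sigma>' - q)"
    using nz by (simp add: nonzero_eq_divide_eq)
  then show ?thesis by (simp add: g_fun_def)
qed

text \<open>Origin of the coefficients \<open>(k + 1) / a i\<close> and \<open>k / a i\<close>: sum
  over the level and divide by its size.\<close>

lemma sum_level_verts:
  assumes "m > 0" "\<forall>u\<in>level_verts i m. c * h u = (e :: real)"
  shows "c / real m * sum h (level_verts i m) = e"
proof -
  have "c * sum h (level_verts i m) = (\<Sum>u\<in>level_verts i m. e)"
    using assms(2) by (simp add: sum_distrib_left)
  also have "\<dots> = real m * e"
    by (simp add: level_verts_def card_cartesian_product)
  finally show ?thesis using assms(1) by (simp add: field_simps)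
qed

lemma finite_level_verts: "finite (level_verts i m)"
  by (simp add: level_verts_def)

lemma threshold_from_wf:
  "finite (pverts (threshold_from i as))"
  "parcs (threshold_from i as) \<subseteq> pverts (threshold_from i as) \<times> pverts (threshold_from i as)"
proof -
  interpret pair_graph "threshold_from i as" by (rule pair_graph_threshold_from)
  show "finite (pverts (threshold_from i as))" by simp
  show "parcs (threshold_from i as) \<subseteq> pverts (threshold_from i as) \<times> pverts (threshold_from i as)"
    using in_arcsD1 in_arcsD2 by auto
qed

section \<open>Descending induction over the levels\<close>

theorem theorem5:
  fixes N :: real and r :: nat and a :: "nat \<Rightarrow> nat" and s :: "nat \<Rightarrow> real"
  assumes "N > 0" and "odd r"
    and "\<And>i. 1 \<le> i \<Longrightarrow> i \<le> r \<Longrightarrow> a i > 0"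
    and "real (a r) > N + 1"
    and "s r = 1 - (N + 1) / real (a r)"
    and "\<And>i. 1 \<le> i \<Longrightarrow> i < r \<Longrightarrow> even i \<Longrightarrow>
           real (a i) > N / s (i + 1) \<and> s i = g_fun (s (i + 1)) (- (N / real (a i)))"
    and "\<And>i. 1 \<le> i \<Longrightarrow> i < r \<Longrightarrow> odd i \<Longrightarrow>
           real (a i) > (N + 1) / (1 - 1 / s (i + 1)) \<and>
           s i = f_fun (s (i + 1)) (1 - (N + 1) / real (a i))"
  shows "eigenvalue_free {0<..N} (threshold_graph (map a [1..<r + 1]))"
proof -
  define G where "G i = threshold_from i (map a [i..<r + 1])" for i
  have "\<not> graph_eigenvalue (G 1) k" if k: "0 < k" "k \<le> N" for k
  proof
    \<comment> \<open>\<open>d\<close> stays arbitrary because a dominating level changes the shift.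
      The last conjunct must be carried along: \<open>d = 0\<close> with nonzero \<sigma> only makes
      the sum of \<open>h\<close> vanish.\<close>
    have "\<exists>\<sigma>. (if odd i then 0 < s i \<and> s i \<le> \<sigma> \<and> \<sigma> < 1 else s i \<le> \<sigma> \<and> \<sigma> < 0)
        \<and> d = - \<sigma> * sum h (pverts (G i)) \<and> (d = 0 \<longrightarrow> (\<forall>u\<in>pverts (G i). h u = 0))"
      if "shifted_eigenvector (G i) k d h" "i \<le> r" "1 \<le> i" for i d h
      using that(2,3,1)
    proof (induction i arbitrary: d rule: inc_induct)
      case base
      let ?W = "level_verts r (a r)" and ?q = "(k + 1) / real (a r)"
      have ar: "a r > 0" using assms(4) \<open>N > 0\<close> by (cases "a r") auto
      have G: "G r = complete_graph_on ?W" using \<open>odd r\<close> by (simp add: G_def)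
      have W: "\<forall>u\<in>?W. (k + 1) * h u = d + sum h ?W"
        using shifted_eigenvector_add_dominating(1)[OF finite_level_verts, of "edgeless_graph_on {}" r "a r" k d h]
          base.prems by (simp add: G complete_graph_on_eq_add_dominating edgeless_graph_on_def)
      have sum: "?q * sum h ?W = d + sum h ?W"
        by (rule sum_level_verts[OF ar W])
      have q: "0 < ?q" "?q \<le> (N + 1) / real (a r)" "(N + 1) / real (a r) < 1"
        using k ar assms(4) by (auto intro: divide_right_mono)
      have V: "pverts (G r) = ?W" by (simp add: G complete_graph_on_def)
      \<comment> \<open>The witness \<open>1 - ?q\<close> is the formula for \<open>s r\<close> with
        \<open>k\<close> in place of \<open>N\<close>.\<close>
      have d: "d = - (1 - ?q) * sum h ?W"
        using sum by (simp add: algebra_simps)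
      moreover have "h u = 0" if "d = 0" "u \<in> ?W" for u
      proof -
        have "sum h ?W = 0" using d that(1) q by auto
        then show ?thesis using W that k by auto
      qed
      moreover have "0 < s r" "s r \<le> 1 - ?q" "1 - ?q < 1"
        using assms(5) q by linarith+
      ultimately show ?case
        using \<open>odd r\<close> V by (intro exI[of _ "1 - ?q"]) auto
    next
      case (step i)
      let ?W = "level_verts i (a i)" and ?t = "sum h (pverts (G (Suc i)))"
      have ai: "a i > 0" using assms(3) step by simp
      \<comment> \<open>The recursive equation of \<open>threshold_from\<close> needs two visible
        list entries; \<open>i < r\<close> supplies them.\<close>
      have "map a [i..<r + 1] = a i # a (Suc i) # map a [Suc (Suc i)..<r + 1]"
        and suc: "map a [Suc i..<r + 1] = a (Suc i) # map a [Suc (Suc i)..<r + 1]"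
        using step.hyps by (simp_all add: upt_conv_Cons del: upt_Suc)
      then have G: "G i = (if odd i then add_dominating ?W (G (Suc i)) else add_isolated ?W (G (Suc i)))"
        by (simp add: G_def)
      have V: "pverts (G i) = ?W \<union> pverts (G (Suc i))"
        by (simp add: G add_dominating_def add_isolated_def)
      have wf: "finite ?W" "finite (pverts (G (Suc i)))" "?W \<inter> pverts (G (Suc i)) = {}"
        "parcs (G (Suc i)) \<subseteq> pverts (G (Suc i)) \<times> pverts (G (Suc i))"
        unfolding G_def by (intro finite_level_verts threshold_from_wf level_verts_disjoint)+
      have t: "sum h (pverts (G i)) = sum h ?W + ?t"
        unfolding V using wf by (intro sum.union_disjoint) auto
      show ?case
      proof (cases "odd i")
        case True
        let ?q = "(k + 1) / real (a i)" and ?Q = "(N + 1) / real (a i)"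
        have "shifted_eigenvector (add_dominating ?W (G (Suc i))) k d h"
          using step.prems G True by simp
        note sh = shifted_eigenvector_add_dominating[OF wf this]
        obtain \<sigma>' where \<sigma>': "s (Suc i) \<le> \<sigma>'" "\<sigma>' < 0" "d + sum h ?W = - \<sigma>' * ?t"
          "d + sum h ?W = 0 \<longrightarrow> (\<forall>u\<in>pverts (G (Suc i)). h u = 0)"
          using step.IH[OF _ sh(2)] True by auto
        define \<sigma> where "\<sigma> = f_fun \<sigma>' (1 - ?q)"
        have A: "?q * sum h ?W = d + sum h ?W + ?t"
          by (rule sum_level_verts[OF ai sh(1)])
        have q: "0 < ?q" "?q \<le> ?Q"
          using k ai by (auto intro: divide_right_mono)
        have si: "real (a i) > (N + 1) / (1 - 1 / s (Suc i))" "s i = f_fun (s (Suc i)) (1 - ?Q)"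
          using assms(7)[of i] step True by auto
        have "1 - 1 / s (Suc i) > 0"
          using \<sigma>' by (simp add: field_simps)
        then have "?Q < 1 - 1 / s (Suc i)"
          using si(1) ai by (simp add: pos_divide_less_eq mult.commute)
        note b = f_fun_bounds[OF \<sigma>'(1,2) q this, folded si(2) \<sigma>_def]
        have d: "d = - \<sigma> * sum h (pverts (G i))"
          unfolding t \<sigma>_def using \<sigma>' q A by (intro f_fun_shift) auto
        have "h u = 0" if "d = 0" "u \<in> pverts (G i)" for u
        proof -
          \<comment> \<open>A zero total kills \<open>h\<close> on the level; then the inner shift
            \<open>d + sum h ?W\<close> is 0 as well, and the induction hypothesis kills
            \<open>h\<close> on the rest.\<close>
          have "sum h ?W + ?t = 0" using d that(1) b unfolding t by auto
          then have W: "\<forall>u\<in>?W. h u = 0" using sh(1) \<open>d = 0\<close> k by auto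
          then have "sum h ?W = 0" by simp
          then show ?thesis using \<sigma>'(4) W that V by auto
        qed
        then show ?thesis
          using b d True by (intro exI[of _ \<sigma>]) auto
      next
        case False
        let ?q = "k / real (a i)" and ?Q = "N / real (a i)"
        have "shifted_eigenvector (add_isolated ?W (G (Suc i))) k d h"
          using step.prems G False by simp
        note sh = shifted_eigenvector_add_isolated[OF wf(3,4) this]
        obtain \<sigma>' where \<sigma>': "0 < s (Suc i)" "s (Suc i) \<le> \<sigma>'" "d = - \<sigma>' * ?t"
          "d = 0 \<longrightarrow> (\<forall>u\<in>pverts (G (Suc i)). h u = 0)"
          using step.IH[OF _ sh(2)] False by auto
        define \<sigma> where "\<sigma> = g_fun \<sigma>' (- ?q)"
        have A: "?q * sum h ?W = d"
          by (rule sum_level_verts[OF ai sh(1)])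
        have q: "0 < ?q" "?q \<le> ?Q"
          using k ai by (auto intro: divide_right_mono)
        have si: "real (a i) > N / s (Suc i)" "s i = g_fun (s (Suc i)) (- ?Q)"
          using assms(6)[of i] step False by auto
        have Q: "?Q < s (Suc i)"
          using si(1) ai \<sigma>'(1) by (simp add: pos_divide_less_eq mult.commute)
        note b = g_fun_bounds[OF \<sigma>'(1,2) q Q, folded si(2) \<sigma>_def]
        have d: "d = - \<sigma> * sum h (pverts (G i))"
          unfolding t \<sigma>_def using \<sigma>' q A Q by (intro g_fun_shift) auto
        have "h u = 0" if "d = 0" "u \<in> pverts (G i)" for u
          using sh(1) \<sigma>'(4) that V k by auto
        then show ?thesis
          using b d False by (intro exI[of _ \<sigma>]) auto
      qed
    qed
    note main = this
    assume "graph_eigenvalue (G 1) k"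
    then obtain h where "shifted_eigenvector (G 1) k 0 h" "\<exists>u\<in>pverts (G 1). h u \<noteq> 0"
      by (rule graph_eigenvalue_imp_shifted_eigenvector)
    moreover have "1 \<le> r" using \<open>odd r\<close> by (cases r) auto
    ultimately show False
      using main[of 1 0 h] by blast
  qed
  then show ?thesis
    by (simp add: eigenvalue_free_def threshold_graph_def G_def)
qed

end
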